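(* For every integer $n$, let $c(n)$, $c_2^+(n)$, $c_4^+(n)$ denote the coefficients of $q^n$ in the $q$-expansions of $j(z)$, $j_2^+(z)$, $j_4^+(z)$ respectively. Then $$c(n)\equiv c_2^+(n)\equiv c_4^+(n)\pmod 2 .$$
   Context: Let $z$ lie in the upper half-plane and $q=e^{2\pi i z}$. The Dedekind eta function is $\eta(z)=q^{1/24}\prod_{n\ge1}(1-q^n)$. Klein's $j$-function is $j(z)=E_4(z)^3/\Delta(z)=q^{-1}+744+\sum_{n\ge1}c(n)q^n$, where $E_4$ is the normalized weight $4$ Eisenstein series and $\Delta(z)=q\prod_{n\ge1}(1-q^n)^{24}$. For $N\in\{2,4\}$ the Fricke hauptmodul is $$j_N^+(z)=\left(\frac{\eta(z)}{\eta(Nz)}\right)^{24/(N-1)}+\frac{24}{N-1}+N^{12/(N-1)}\left(\frac{\eta(Nz)}{\eta(z)}\right)^{24/(N-1)},$$ so $j_2^+=(\eta(z)/\eta(2z))^{24}+24+2^{12}(\eta(2z)/\eta(z))^{24}$ and $j_4^+=(\eta(z)/\eta(4z))^{8}+8+4^{4}(\eta(4z)/\eta(z))^{8}$. These have $q$-expansions with integer coefficients; $c_N^+(n)$ is the coefficient of $q^n$ in $j_N^+(z)$. *)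

theory Defs
  imports "HOL-Complex_Analysis.Complex_Analysis" "HOL-Number_Theory.Cong"
begin

definition to_q :: "complex \<Rightarrow> complex" where
  "to_q z = exp (2 * of_real pi * \<i> * z)"

(* The factor q^(1/24) is exp (2 pi i z / 24), not a principal branch of a root of q. *)
definition dedekind_eta :: "complex \<Rightarrow> complex" where
  "dedekind_eta z = exp (2 * of_real pi * \<i> * z / 24) * (\<Prod>n. 1 - to_q z ^ Suc n)"

definition modular_discr :: "complex \<Rightarrow> complex" where
  "modular_discr z = to_q z * (\<Prod>n. (1 - to_q z ^ Suc n) ^ 24)"

definition divisor_sigma :: "nat \<Rightarrow> nat \<Rightarrow> nat" where
  "divisor_sigma k n = (\<Sum>d | d dvd n. d ^ k)"

(* Normalized to have constant term 1: 1 - (2 k / B_k) * (SUM n >= 1. sigma_(k-1)(n) q^n)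
   with k = 4 and B_4 = -1/30. *)
definition eisenstein_E4 :: "complex \<Rightarrow> complex" where
  "eisenstein_E4 z = 1 + 240 * (\<Sum>n. of_nat (divisor_sigma 3 (Suc n)) * to_q z ^ Suc n)"

definition klein_j :: "complex \<Rightarrow> complex" where
  "klein_j z = eisenstein_E4 z ^ 3 / modular_discr z"

(* Meant for N = 2 and N = 4, where the natural-number quotients are exact. *)
definition fricke_hauptmodul :: "nat \<Rightarrow> complex \<Rightarrow> complex" where
  "fricke_hauptmodul N z =
     (dedekind_eta z / dedekind_eta (of_nat N * z)) ^ (24 div (N - 1))
     + of_nat (24 div (N - 1))
     + of_nat N ^ (12 div (N - 1)) *
       (dedekind_eta (of_nat N * z) / dedekind_eta z) ^ (24 div (N - 1))"

(* F is the Laurent series in q (finitely many negative powers) of f on the whole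
   upper half-plane; there q ranges over the punctured unit disc. *)
definition has_q_expansion :: "(complex \<Rightarrow> complex) \<Rightarrow> complex fls \<Rightarrow> bool" where
  "has_q_expansion f F \<longleftrightarrow>
     fls_conv_radius F \<ge> 1 \<and> (\<forall>z. Im z > 0 \<longrightarrow> f z = eval_fls F (to_q z))"

lemma to_q_surj:
  assumes "q \<noteq> 0" "norm q < 1"
  obtains z where "Im z > 0" "to_q z = q"
proof
  let ?z = "Ln q / (2 * of_real pi * \<i>)"
  show "to_q ?z = q"
    using assms by (simp add: to_q_def)
  have "Im ?z = - Re (Ln q) / (2 * pi)"
    by (simp add: complex_eq_iff Im_divide power2_eq_square)
  also have "\<dots> > 0"
    using assms by (simp add: divide_neg_pos ln_less_zero)
  finally show "Im ?z > 0" .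
qed

lemma has_q_expansion_unique:
  assumes F: "has_q_expansion f F" and G: "has_q_expansion f G"
  shows "F = G"
proof -
  have pos: "fls_conv_radius F > 0" "fls_conv_radius G > 0"
    using F G by (auto simp: has_q_expansion_def intro: less_le_trans[of 0 1])
  have "\<forall>\<^sub>F q in at 0. q \<in> ball (0::complex) 1 - {0}"
    by (rule eventually_at_in_open) auto
  hence "\<forall>\<^sub>F q in at 0. eval_fls F q = eval_fls G q"
  proof eventually_elim
    case (elim q)
    then obtain z where "Im z > 0" "to_q z = q"
      by (auto elim: to_q_surj)
    thus ?case
      using F G by (metis has_q_expansion_def)
  qed
  moreover have "eval_fls F has_laurent_expansion F" "eval_fls G has_laurent_expansion G"
    using pos by (auto intro!: eval_fls_has_laurent_expansion)
  ultimately show ?thesis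
    using has_laurent_expansion_cong has_laurent_expansion_unique by blast
qed

definition q_expansion :: "(complex \<Rightarrow> complex) \<Rightarrow> complex fls" where
  "q_expansion f = (THE F. has_q_expansion f F)"

lemma q_expansion_eqI: "has_q_expansion f F \<Longrightarrow> q_expansion f = F"
  unfolding q_expansion_def using has_q_expansion_unique by blast

definition q_coeff :: "(complex \<Rightarrow> complex) \<Rightarrow> int \<Rightarrow> complex" where
  "q_coeff f n = fls_nth (q_expansion f) n"

end

theory Submission
  imports Defs "HOL-Real_Asymp.Real_Asymp"
begin

text \<open>
  Write \<open>P(q)\<close> for the Euler product, the product of all \<open>1 - q^n\<close> with \<open>n \<ge> 1\<close>. Modulo 2 we have
  \<open>E_4 = 1\<close>, hence \<open>q j = 1 / P(q)^24\<close>. By the Frobenius congruence \<open>P(q^2) = P(q)^2\<close>, used twice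
  for \<open>N = 4\<close>, also \<open>P(q^N) = P(q)^N\<close>. So, with \<open>k = 24 / (N - 1)\<close>, the only term
  \<open>(P(q) / P(q^N))^k\<close> of \<open>q j_N\<close> not divisible by 2 is congruent to \<open>P(q)^(k - N k) = 1 / P(q)^24\<close> as well.
  Taylor coefficients at 0 are continuous under locally uniform limits and the integers are closed,
  so the integrality and congruence of the finite products carry over to \<open>P\<close>.
\<close>

section \<open>Functions on the unit disc with integer Taylor coefficients\<close>

text \<open>Integrality is attached to holomorphic functions instead of formal power series, so that
  theorems on uniform limits apply. Holomorphy on the whole disc also gives
  \<open>fps_expansion f 0\<close> a radius of convergence of at least 1.\<close>

definition int_coeffs :: "(complex \<Rightarrow> complex) \<Rightarrow> bool" where
  "int_coeffs f \<longleftrightarrow>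
     f holomorphic_on ball 0 1 \<and> (\<forall>n. fps_nth (fps_expansion f 0) n \<in> \<int>)"

lemma int_coeffsI:
  assumes "f holomorphic_on ball 0 1" "f has_fps_expansion F" "\<And>n. fps_nth F n \<in> \<int>"
  shows "int_coeffs f"
  using assms by (simp add: int_coeffs_def fps_expansion_eqI)

lemma int_coeffsE:
  assumes "int_coeffs f"
  obtains F where "f holomorphic_on ball 0 1" "f has_fps_expansion F" "\<And>n. fps_nth F n \<in> \<int>"
  using assms unfolding int_coeffs_def
  by (meson centre_in_ball has_fps_expansion_fps_expansion open_ball zero_less_one)

lemma int_coeffs_cong:
  assumes "int_coeffs f" "\<And>q. norm q < 1 \<Longrightarrow> f q = g q"
  shows "int_coeffs g"
proof -
  obtain F where F: "f holomorphic_on ball 0 1" "f has_fps_expansion F" "\<And>n. fps_nth F n \<in> \<int>"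
    using assms(1) by (rule int_coeffsE) blast
  have "\<forall>\<^sub>F q in nhds 0. q \<in> ball (0::complex) 1"
    by (rule eventually_nhds_in_open) auto
  then have "\<forall>\<^sub>F q in nhds 0. f q = g q"
    by eventually_elim (use assms(2) in auto)
  then have "g has_fps_expansion F"
    using F(2) has_fps_expansion_cong by blast
  moreover have "g holomorphic_on ball 0 1"
    using F(1) assms(2) by (subst holomorphic_cong[of _ _ _ f]) auto
  ultimately show ?thesis
    using F(3) by (intro int_coeffsI)
qed

lemma int_coeffs_of_int [simp]: "int_coeffs (\<lambda>_. of_int m)"
  by (rule int_coeffsI[of _ "fps_const (of_int m)"]) auto

lemma int_coeffs_0 [simp]: "int_coeffs (\<lambda>_. 0)"
  using int_coeffs_of_int[of 0] by simp

lemma int_coeffs_1 [simp]: "int_coeffs (\<lambda>_. 1)"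
  using int_coeffs_of_int[of 1] by simp

lemma int_coeffs_numeral [simp]: "int_coeffs (\<lambda>_. numeral n)"
  using int_coeffs_of_int[of "numeral n"] by simp

lemma int_coeffs_id [simp]: "int_coeffs (\<lambda>q. q)"
  by (rule int_coeffsI[OF _ has_fps_expansion_fps_X]) (auto simp: fps_X_def)

lemma int_coeffs_add:
  assumes "int_coeffs f" "int_coeffs g"
  shows "int_coeffs (\<lambda>q. f q + g q)"
  using assms by (elim int_coeffsE, intro int_coeffsI)
    (auto intro!: holomorphic_intros has_fps_expansion_add)

lemma int_coeffs_minus:
  assumes "int_coeffs f"
  shows "int_coeffs (\<lambda>q. - f q)"
  using assms by (elim int_coeffsE, intro int_coeffsI)
    (auto intro!: holomorphic_intros has_fps_expansion_minus)

lemma int_coeffs_diff: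
  assumes "int_coeffs f" "int_coeffs g"
  shows "int_coeffs (\<lambda>q. f q - g q)"
  using int_coeffs_add[OF assms(1) int_coeffs_minus[OF assms(2)]] by simp

lemma int_coeffs_mult:
  assumes "int_coeffs f" "int_coeffs g"
  shows "int_coeffs (\<lambda>q. f q * g q)"
  using assms by (elim int_coeffsE, intro int_coeffsI)
    (auto intro!: holomorphic_intros has_fps_expansion_mult Ints_sum Ints_mult simp: fps_mult_nth)

lemma int_coeffs_power: "int_coeffs f \<Longrightarrow> int_coeffs (\<lambda>q. f q ^ k)"
  by (induction k) (auto intro: int_coeffs_mult)

lemma int_coeffs_prod:
  "(\<And>i. i \<in> I \<Longrightarrow> int_coeffs (f i)) \<Longrightarrow> int_coeffs (\<lambda>q. \<Prod>i\<in>I. f i q)"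
  by (induction I rule: infinite_finite_induct) (auto intro: int_coeffs_mult)

text \<open>Comparing coefficients in \<open>F * inverse F = 1\<close> gives a recursion for those
  of the inverse; since the constant term of \<open>F\<close> is 1, it involves no division.\<close>

lemma fps_inverse_Ints:
  fixes F :: "complex fps"
  assumes "\<And>n. fps_nth F n \<in> \<int>" "fps_nth F 0 = 1"
  shows "fps_nth (inverse F) n \<in> \<int>"
proof (induction n rule: less_induct)
  case (less n)
  have "F * inverse F = 1"
    using assms(2) by (simp add: inverse_mult_eq_1')
  then have "(\<Sum>i=0..n. fps_nth F i * fps_nth (inverse F) (n - i)) = (if n = 0 then 1 else 0)"
    by (metis fps_mult_nth fps_one_nth)
  moreover have "(\<Sum>i=0..n. fps_nth F i * fps_nth (inverse F) (n - i)) =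
      fps_nth (inverse F) n + (\<Sum>i=Suc 0..n. fps_nth F i * fps_nth (inverse F) (n - i))"
    using assms(2) by (subst sum.atLeast_Suc_atMost) auto
  ultimately have "fps_nth (inverse F) n =
      (if n = 0 then 1 else 0) - (\<Sum>i=Suc 0..n. fps_nth F i * fps_nth (inverse F) (n - i))"
    by (simp only: eq_diff_eq)
  also have "\<dots> \<in> \<int>"
    using assms(1) less by (intro Ints_diff Ints_sum Ints_mult) auto
  finally show ?case .
qed

lemma int_coeffs_inverse:
  assumes "int_coeffs f" "f 0 = 1" "\<And>q. norm q < 1 \<Longrightarrow> f q \<noteq> 0"
  shows "int_coeffs (\<lambda>q. inverse (f q))"
proof -
  obtain F where F: "f holomorphic_on ball 0 1" "f has_fps_expansion F" "\<And>n. fps_nth F n \<in> \<int>"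
    using assms(1) by (rule int_coeffsE) blast
  have F0: "fps_nth F 0 = 1"
    using has_fps_expansion_imp_0_eq_fps_nth_0[OF F(2)] assms(2) by simp
  show ?thesis
  proof (rule int_coeffsI)
    show "(\<lambda>q. inverse (f q)) has_fps_expansion inverse F"
      using F F0 by (intro has_fps_expansion_inverse) auto
  qed (use F F0 assms(3) in \<open>auto intro!: holomorphic_intros fps_inverse_Ints\<close>)
qed

text \<open>Only derivatives at 0 enter, so uniform convergence on a small disc about 0 suffices.
  They converge to those of the limit, and a convergent sequence of integers has an integer
  limit.\<close>

lemma int_coeffs_uniform_limit:
  assumes f: "\<And>N. int_coeffs (f N)" and g: "g holomorphic_on ball 0 1"
    and lim: "uniform_limit (ball 0 r) f g sequentially" and r: "0 < r" "r \<le> 1"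
  shows "int_coeffs g"
proof -
  have hol: "f N holomorphic_on ball 0 r" for N
    using f[of N] r by (auto simp: int_coeffs_def intro: holomorphic_on_subset)
  have "fps_nth (fps_expansion g 0) n \<in> \<int>" for n
  proof (rule Lim_in_closed_set[OF closed_Ints])
    have "(\<lambda>N. (deriv ^^ n) (f N) 0) \<longlonglongrightarrow> (deriv ^^ n) g 0"
      by (rule higher_deriv_complex_uniform_limit[OF lim]) (use hol r in auto)
    then show "(\<lambda>N. fps_nth (fps_expansion (f N) 0) n) \<longlonglongrightarrow> fps_nth (fps_expansion g 0) n"
      by (auto simp: fps_expansion_def intro!: tendsto_intros)
  qed (use f in \<open>auto simp: int_coeffs_def\<close>)
  with g show ?thesis
    by (simp add: int_coeffs_def)
qed

section \<open>Congruence modulo 2\<close>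

text \<open>Coefficientwise congruence is encoded as integrality of half the difference, so that
  every rule for congruences reduces to closure properties of \<open>int_coeffs\<close>.\<close>

definition cong_mod2 :: "(complex \<Rightarrow> complex) \<Rightarrow> (complex \<Rightarrow> complex) \<Rightarrow> bool" where
  "cong_mod2 f g \<longleftrightarrow> int_coeffs f \<and> int_coeffs g \<and> int_coeffs (\<lambda>q. (f q - g q) / 2)"

lemma cong_mod2I:
  assumes "int_coeffs g" "int_coeffs h"
    and "\<And>q. norm q < 1 \<Longrightarrow> f q = g q + 2 * h q"
  shows "cong_mod2 f g"
proof -
  have "int_coeffs (\<lambda>q. g q + 2 * h q)"
    using assms by (intro int_coeffs_add int_coeffs_mult[of "\<lambda>_. 2"]) auto
  then have "int_coeffs f"
    by (rule int_coeffs_cong) (simp add: assms(3))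
  moreover have "int_coeffs (\<lambda>q. (f q - g q) / 2)"
    using assms(2) by (rule int_coeffs_cong) (simp add: assms(3))
  ultimately show ?thesis
    using assms(1) by (simp add: cong_mod2_def)
qed

lemma cong_mod2_refl: "int_coeffs f \<Longrightarrow> cong_mod2 f f"
  by (simp add: cong_mod2_def)

lemma cong_mod2_sym:
  assumes "cong_mod2 f g"
  shows "cong_mod2 g f"
  using assms int_coeffs_minus[of "\<lambda>q. (f q - g q) / 2"]
  by (auto simp: cong_mod2_def minus_divide_left)

lemma cong_mod2_trans:
  assumes "cong_mod2 f g" "cong_mod2 g h"
  shows "cong_mod2 f h"
  using assms int_coeffs_add[of "\<lambda>q. (f q - g q) / 2" "\<lambda>q. (g q - h q) / 2"]
  by (auto simp: cong_mod2_def add_divide_distrib[symmetric])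

lemma cong_mod2_mult:
  assumes "cong_mod2 f g" "cong_mod2 f' g'"
  shows "cong_mod2 (\<lambda>q. f q * f' q) (\<lambda>q. g q * g' q)"
proof (rule cong_mod2I)
  \<comment> \<open>From f f' - g g' = (f - g) f' + g (f' - g').\<close>
  show "int_coeffs (\<lambda>q. (f q - g q) / 2 * f' q + g q * ((f' q - g' q) / 2))"
    using assms unfolding cong_mod2_def by (intro int_coeffs_add int_coeffs_mult) auto
qed (use assms in \<open>auto simp: cong_mod2_def field_simps intro: int_coeffs_mult\<close>)

lemma cong_mod2_power:
  "cong_mod2 f g \<Longrightarrow> cong_mod2 (\<lambda>q. f q ^ k) (\<lambda>q. g q ^ k)"
  by (induction k) (auto intro: cong_mod2_mult cong_mod2_refl)

lemma cong_mod2_prod: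
  "(\<And>i. i \<in> I \<Longrightarrow> cong_mod2 (f i) (g i)) \<Longrightarrow>
     cong_mod2 (\<lambda>q. \<Prod>i\<in>I. f i q) (\<lambda>q. \<Prod>i\<in>I. g i q)"
  by (induction I rule: infinite_finite_induct) (auto intro: cong_mod2_mult cong_mod2_refl)

lemma cong_mod2_inverse:
  assumes "cong_mod2 f g" "f 0 = 1" "g 0 = 1"
    and nz: "\<And>q. norm q < 1 \<Longrightarrow> f q \<noteq> 0" "\<And>q. norm q < 1 \<Longrightarrow> g q \<noteq> 0"
  shows "cong_mod2 (\<lambda>q. inverse (f q)) (\<lambda>q. inverse (g q))"
proof (rule cong_mod2I)
  have "int_coeffs (\<lambda>q. inverse (f q))"
    using assms by (auto simp: cong_mod2_def intro: int_coeffs_inverse)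
  moreover show "int_coeffs (\<lambda>q. inverse (g q))"
    using assms by (auto simp: cong_mod2_def intro: int_coeffs_inverse)
  \<comment> \<open>From 1/f - 1/g = -(f - g) / (f g).\<close>
  ultimately show "int_coeffs (\<lambda>q. - ((f q - g q) / 2) * inverse (f q) * inverse (g q))"
    using assms(1) unfolding cong_mod2_def by (intro int_coeffs_mult int_coeffs_minus) auto
qed (use nz in \<open>auto simp: field_simps\<close>)

text \<open>Half the difference converges uniformly as well, so each of the three integrality
  conditions passes to the limit by itself.\<close>

lemma cong_mod2_uniform_limit:
  assumes "\<And>N. cong_mod2 (f N) (f' N)" "g holomorphic_on ball 0 1" "g' holomorphic_on ball 0 1"
    and "uniform_limit (ball 0 r) f g sequentially" "uniform_limit (ball 0 r) f' g' sequentially"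
    and "0 < r" "r \<le> 1"
  shows "cong_mod2 g g'"
proof -
  have "uniform_limit (ball 0 r) (\<lambda>N q. (f N q - f' N q) / 2) (\<lambda>q. (g q - g' q) / 2) sequentially"
    unfolding divide_inverse
    by (intro bounded_linear.uniform_limit[OF bounded_linear_mult_left] uniform_limit_intros assms)
  from int_coeffs_uniform_limit[OF _ _ this assms(6,7)]
  have "int_coeffs (\<lambda>q. (g q - g' q) / 2)"
    using assms(1-3) by (simp add: cong_mod2_def holomorphic_on_diff holomorphic_on_divide)
  moreover have "int_coeffs g"
    by (rule int_coeffs_uniform_limit[OF _ assms(2,4,6,7)]) (use assms(1) in \<open>simp add: cong_mod2_def\<close>)
  moreover have "int_coeffs g'"
    by (rule int_coeffs_uniform_limit[OF _ assms(3,5,6,7)]) (use assms(1) in \<open>simp add: cong_mod2_def\<close>)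
  ultimately show ?thesis
    by (simp add: cong_mod2_def)
qed

text \<open>This leads back from functions to integers: the expansion of f = g + 2 h is compared in
  degree n, where h is half the difference.\<close>

lemma cong_mod2_fps_nth:
  assumes "cong_mod2 f g"
  obtains a b :: int where "fps_nth (fps_expansion f 0) n = of_int a"
    "fps_nth (fps_expansion g 0) n = of_int b" "[a = b] (mod 2)"
proof -
  define h where "h = (\<lambda>q. (f q - g q) / 2)"
  have int: "int_coeffs f" "int_coeffs g" "int_coeffs h"
    using assms by (auto simp: cong_mod2_def h_def)
  obtain G where G: "g has_fps_expansion G"
    using int(2) by (rule int_coeffsE) blast
  obtain H where H: "h has_fps_expansion H"
    using int(3) by (rule int_coeffsE) blast
  have "(\<lambda>q. g q + 2 * h q) has_fps_expansion G + fps_const 2 * H"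
    by (intro fps_expansion_intros G H)
  moreover have "(\<lambda>q. g q + 2 * h q) = f"
    by (simp add: h_def field_simps)
  ultimately have *: "fps_nth (fps_expansion f 0) n =
      fps_nth (fps_expansion g 0) n + 2 * fps_nth (fps_expansion h 0) n"
    using G H by (simp add: fps_expansion_eqI)
  obtain b where "fps_nth (fps_expansion g 0) n = of_int b"
    using int(2) unfolding int_coeffs_def by (meson Ints_cases)
  moreover obtain d where "fps_nth (fps_expansion h 0) n = of_int d"
    using int(3) unfolding int_coeffs_def by (meson Ints_cases)
  ultimately show thesis
    using * by (intro that[of "b + 2 * d" b]) (auto simp: cong_def)
qed

section \<open>The Euler product\<close>

definition euler_prod :: "complex \<Rightarrow> complex" where
  "euler_prod q = (\<Prod>n. 1 - q ^ Suc n)"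

lemma convergent_prod_euler:
  fixes q :: complex
  assumes "norm q < 1"
  shows "convergent_prod (\<lambda>n. 1 - q ^ Suc n)"
proof -
  have "summable (\<lambda>n. norm q ^ Suc n)"
    using assms by (subst summable_Suc_iff) (simp add: summable_geometric)
  then show ?thesis
    by (intro abs_convergent_prod_imp_convergent_prod summable_imp_abs_convergent_prod)
       (simp add: norm_mult norm_power)
qed

lemma norm_power_less_one:
  fixes q :: "'a :: real_normed_div_algebra"
  assumes "norm q < 1" "m > 0"
  shows "norm (q ^ m) < 1"
  using power_strict_mono[of "norm q" 1 m] assms by (simp add: norm_power)

lemma one_minus_power_nonzero:
  fixes q :: complex
  assumes "norm q < 1"
  shows "1 - q ^ Suc n \<noteq> 0"
  using norm_power_less_one[OF assms, of "Suc n"]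
  by (metis eq_iff_diff_eq_0 less_irrefl norm_one zero_less_Suc)

lemma euler_prod_nonzero:
  assumes "norm q < 1"
  shows "euler_prod q \<noteq> 0"
  unfolding euler_prod_def
  using assms by (intro prodinf_nonzero convergent_prod_euler one_minus_power_nonzero)

lemma euler_prod_0 [simp]: "euler_prod 0 = 1"
  by (simp add: euler_prod_def)

lemma uniform_limit_euler_prod:
  assumes "r < 1"
  shows "uniform_limit (cball 0 r) (\<lambda>N q. \<Prod>n<N. 1 - q ^ Suc n) euler_prod sequentially"
proof -
  have "uniformly_convergent_on (cball 0 r) (\<lambda>N q::complex. \<Sum>n<N. norm ((1 - q ^ Suc n) - 1))"
  \<comment> \<open>For negative r the disc is empty; otherwise the geometric series in r is the
    majorant for the M-test.\<close>
  proof (cases "r < 0")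
    case False
    then have "summable (\<lambda>n. r ^ Suc n)"
      using assms by (subst summable_Suc_iff) (simp add: summable_geometric)
    then show ?thesis
      by (intro Weierstrass_m_test'[where M = "\<lambda>n. r ^ Suc n"])
         (auto simp: norm_power norm_mult simp del: power_Suc intro!: power_mono)
  qed (simp add: uniformly_convergent_on_def uniform_limit_iff)
  then have "uniformly_convergent_on (cball 0 r) (\<lambda>N q::complex. \<Prod>n<N. 1 - q ^ Suc n)"
    by (intro uniformly_convergent_on_prod') (auto intro!: continuous_intros)
  then have "uniform_limit (cball 0 r) (\<lambda>N q. \<Prod>n<N. 1 - q ^ Suc n)
      (\<lambda>q::complex. lim (\<lambda>N. \<Prod>n<N. 1 - q ^ Suc n)) sequentially"
    by (simp only: uniformly_convergent_uniform_limit_iff)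
  moreover have "euler_prod q = lim (\<lambda>N. \<Prod>n<N. 1 - q ^ Suc n)" if "q \<in> cball 0 r" for q
    unfolding euler_prod_def using that assms
    by (intro prodinf_eq_lim' convergent_prod_euler one_minus_power_nonzero) auto
  ultimately show ?thesis
    by (subst uniform_limit_cong') auto
qed

lemma holomorphic_euler_prod: "euler_prod holomorphic_on ball 0 1"
proof (rule holomorphic_uniform_sequence)
  fix q :: complex assume "q \<in> ball 0 1"
  \<comment> \<open>Half the distance from q to the unit circle: the closed disc of this radius
    about q lies in a disc about 0 of radius below 1, where the finite products converge
    uniformly.\<close>
  define d where "d = (1 - norm q) / 2"
  have d: "d > 0" and nd: "norm q + d < 1"
    using \<open>q \<in> ball 0 1\<close> by (auto simp: d_def field_simps)
  have sub: "cball q d \<subseteq> cball 0 (norm q + d)"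
    by (auto simp: cball_subset_cball_iff)
  then have "uniform_limit (cball q d) (\<lambda>N q. \<Prod>n<N. 1 - q ^ Suc n) euler_prod sequentially"
    using nd uniform_limit_euler_prod uniform_limit_on_subset by blast
  moreover have "cball q d \<subseteq> ball 0 1"
    using sub nd by auto
  ultimately show "\<exists>d>0. cball q d \<subseteq> ball 0 1 \<and>
      uniform_limit (cball q d) (\<lambda>N q. \<Prod>n<N. 1 - q ^ Suc n) euler_prod sequentially"
    using d by blast
qed (auto intro!: holomorphic_intros)

lemma holomorphic_euler_prod_power:
  assumes "m > 0"
  shows "(\<lambda>q. euler_prod (q ^ m)) holomorphic_on ball 0 1"
proof -
  have "euler_prod \<circ> (\<lambda>q. q ^ m) holomorphic_on ball 0 1"
    using assms norm_power_less_one
    by (intro holomorphic_on_compose_gen[OF _ holomorphic_euler_prod]) (auto intro!: holomorphic_intros)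
  then show ?thesis
    by (simp add: o_def)
qed

lemma uniform_limit_euler_prod_power:
  assumes "m > 0"
  shows "uniform_limit (ball 0 (1/2)) (\<lambda>N q. \<Prod>n<N. 1 - (q ^ m) ^ Suc n)
           (\<lambda>q. euler_prod (q ^ m)) sequentially"
proof (rule uniform_limit_compose'[OF uniform_limit_euler_prod])
  \<comment> \<open>Taking the m-th power maps the disc of radius 1/2 into itself, so the uniform
    convergence there can be pulled back along it.\<close>
  have "norm (q ^ m) \<le> 1 / 2" if "norm q < 1 / 2" for q :: complex
  proof -
    have "norm q ^ m \<le> norm q ^ 1"
      using assms that by (intro power_decreasing) auto
    with that show ?thesis by (simp add: norm_power)
  qed
  then show "(\<lambda>q. q ^ m) \<in> ball (0::complex) (1/2) \<rightarrow> cball 0 (1/2)"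
    by auto
qed simp

text \<open>The Frobenius congruence, obtained factor by factor from
  1 - x^2 = (1 - x)^2 + 2 (x - x^2).\<close>

lemma euler_prod_double_cong:
  assumes "m > 0"
  shows "cong_mod2 (\<lambda>q. euler_prod (q ^ (2 * m))) (\<lambda>q. euler_prod (q ^ m) ^ 2)"
proof (rule cong_mod2_uniform_limit)
  fix N
  have "cong_mod2 (\<lambda>q. 1 - (q ^ (2 * m)) ^ Suc n) (\<lambda>q. (1 - (q ^ m) ^ Suc n) ^ 2)" for n
  proof (rule cong_mod2I)
    show "int_coeffs (\<lambda>q. (q ^ m) ^ Suc n - (q ^ (2 * m)) ^ Suc n)"
      by (intro int_coeffs_diff int_coeffs_power int_coeffs_id)
    fix q :: complex
    have "(q ^ (2 * m)) ^ Suc n = ((q ^ m) ^ Suc n) ^ 2"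
      by (simp only: power_mult[symmetric] mult_ac)
    then show "1 - (q ^ (2 * m)) ^ Suc n =
        (1 - (q ^ m) ^ Suc n) ^ 2 + 2 * ((q ^ m) ^ Suc n - (q ^ (2 * m)) ^ Suc n)"
      by (simp only:) (simp add: power2_eq_square algebra_simps del: power_Suc)
  qed (intro int_coeffs_diff int_coeffs_power int_coeffs_id int_coeffs_1)+
  then show "cong_mod2 (\<lambda>q. \<Prod>n<N. 1 - (q ^ (2 * m)) ^ Suc n) (\<lambda>q. (\<Prod>n<N. 1 - (q ^ m) ^ Suc n) ^ 2)"
    unfolding prod_power_distrib by (rule cong_mod2_prod)
next
  \<comment> \<open>Squaring preserves uniform convergence when the limit is bounded; the bound
    comes from compactness of the closed disc.\<close>
  have "bounded ((\<lambda>q. euler_prod (q ^ m)) ` cball 0 (1/2))"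
    by (intro compact_imp_bounded compact_continuous_image holomorphic_on_imp_continuous_on
          holomorphic_on_subset[OF holomorphic_euler_prod_power[OF assms]]) auto
  then have "bounded ((\<lambda>q. euler_prod (q ^ m)) ` ball 0 (1/2))"
    by (rule bounded_subset) (auto intro!: image_mono)
  then show "uniform_limit (ball 0 (1/2)) (\<lambda>N q. (\<Prod>n<N. 1 - (q ^ m) ^ Suc n) ^ 2)
      (\<lambda>q. euler_prod (q ^ m) ^ 2) sequentially"
    unfolding power2_eq_square by (intro uniform_lim_mult uniform_limit_euler_prod_power assms)
next
  show "(\<lambda>q. euler_prod (q ^ (2 * m))) holomorphic_on ball 0 1"
    using assms by (intro holomorphic_euler_prod_power) auto
  show "(\<lambda>q. euler_prod (q ^ m) ^ 2) holomorphic_on ball 0 1"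
    using assms by (intro holomorphic_on_power holomorphic_euler_prod_power)
  show "uniform_limit (ball 0 (1/2)) (\<lambda>N q. \<Prod>n<N. 1 - (q ^ (2 * m)) ^ Suc n)
      (\<lambda>q. euler_prod (q ^ (2 * m))) sequentially"
    using assms by (intro uniform_limit_euler_prod_power) auto
qed auto

lemma int_coeffs_euler_prod: "int_coeffs euler_prod"
proof (rule int_coeffs_uniform_limit)
  show "int_coeffs (\<lambda>q. \<Prod>n<N. 1 - q ^ Suc n)" for N
    by (intro int_coeffs_prod int_coeffs_diff int_coeffs_power int_coeffs_id int_coeffs_1)
  show "uniform_limit (ball 0 (1/2)) (\<lambda>N q. \<Prod>n<N. 1 - q ^ Suc n) euler_prod sequentially"
    by (rule uniform_limit_on_subset[OF uniform_limit_euler_prod[of "1/2"]]) auto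
qed (auto intro: holomorphic_euler_prod)

lemma euler_prod_square_cong: "cong_mod2 (\<lambda>q. euler_prod (q ^ 2)) (\<lambda>q. euler_prod q ^ 2)"
  using euler_prod_double_cong[of 1] by simp

lemma euler_prod_fourth_cong: "cong_mod2 (\<lambda>q. euler_prod (q ^ 4)) (\<lambda>q. euler_prod q ^ 4)"
  using cong_mod2_trans[OF euler_prod_double_cong[of 2] cong_mod2_power[OF euler_prod_square_cong, of 2]]
  by simp

section \<open>The Eisenstein series\<close>

text \<open>There are at most n divisors, each at most n. This crude polynomial bound is enough for
  convergence on the unit disc.\<close>

lemma divisor_sigma_le: "divisor_sigma k n \<le> n ^ Suc k"
proof (cases "n = 0")
  case False
  then have "{d. d dvd n} \<subseteq> {1..n}"
    by (auto simp: Suc_le_eq dvd_imp_le intro: Nat.gr0I)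
  then have "divisor_sigma k n \<le> (\<Sum>d\<in>{1..n}. d ^ k)"
    unfolding divisor_sigma_def by (intro sum_mono2) auto
  also have "\<dots> \<le> (\<Sum>d\<in>{1..n}. n ^ k)"
    by (intro sum_mono power_mono) auto
  finally show ?thesis by simp
qed (simp add: divisor_sigma_def)

text \<open>The constant coefficient vanishes since \<open>divisor_sigma k 0\<close> is a sum over an infinite set.\<close>

definition sigma_fps :: "nat \<Rightarrow> complex fps" where
  "sigma_fps k = Abs_fps (\<lambda>n. of_nat (divisor_sigma k n))"

lemma fps_conv_radius_sigma: "fps_conv_radius (sigma_fps k) \<ge> 1"
  unfolding fps_conv_radius_def
proof (rule conv_radius_geI_ex')
  fix r :: real assume r: "0 < r" "ereal r < 1"
  \<comment> \<open>For r < 1 the exponential decay beats the polynomial, so the convergent series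
    of 1/n^2 serves as a majorant.\<close>
  have "(\<lambda>n. real n ^ Suc k * r ^ n) \<in> O(\<lambda>n. inverse (real n ^ 2))"
    using r by real_asymp
  then have "summable (\<lambda>n. real n ^ Suc k * r ^ n)"
    by (rule summable_comparison_test_bigo[rotated]) (simp add: inverse_power_summable)
  then show "summable (\<lambda>n. fps_nth (sigma_fps k) n * of_real r ^ n)"
  proof (rule summable_comparison_test'[where N = 0])
    fix n
    have "real (divisor_sigma k n) \<le> real n ^ Suc k"
      by (metis divisor_sigma_le of_nat_le_iff of_nat_power)
    then show "norm (fps_nth (sigma_fps k) n * of_real r ^ n) \<le> real n ^ Suc k * r ^ n"
      using r by (simp add: sigma_fps_def norm_mult norm_power mult_right_mono del: power_Suc)
  qed
qed

definition eisenstein_q :: "complex \<Rightarrow> complex" where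
  "eisenstein_q q = 1 + 240 * (\<Sum>n. of_nat (divisor_sigma 3 (Suc n)) * q ^ Suc n)"

text \<open>The factor 240 is split as 2 * 120 to match the shape g + 2 h of
  \<open>cong_mod2I\<close>, with g = 1.\<close>

lemma eisenstein_q_eq:
  assumes "norm q < 1"
  shows "eisenstein_q q = 1 + 2 * (120 * eval_fps (sigma_fps 3) q)"
proof -
  have "ereal (norm q) < fps_conv_radius (sigma_fps 3)"
    using assms fps_conv_radius_sigma[of 3] by (simp add: less_le_trans[of _ 1])
  from summable_fps[OF this] have "eval_fps (sigma_fps 3) q =
      (\<Sum>n. fps_nth (sigma_fps 3) (Suc n) * q ^ Suc n) + fps_nth (sigma_fps 3) 0"
    unfolding eval_fps_def by (subst suminf_split_head) auto
  then show ?thesis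
    by (simp add: eisenstein_q_def sigma_fps_def divisor_sigma_def)
qed

lemma int_coeffs_sigma: "int_coeffs (eval_fps (sigma_fps k))"
proof (rule int_coeffsI)
  have "ball 0 1 \<subseteq> eball (0::complex) (fps_conv_radius (sigma_fps k))"
    using fps_conv_radius_sigma[of k] by (auto simp: in_eball_iff less_le_trans[of _ 1])
  then show "eval_fps (sigma_fps k) holomorphic_on ball 0 1"
    by (rule holomorphic_on_eval_fps)
  show "eval_fps (sigma_fps k) has_fps_expansion sigma_fps k"
    using fps_conv_radius_sigma[of k] by (intro eval_fps_has_fps_expansion) (simp add: less_le_trans[of _ 1])
qed (simp add: sigma_fps_def)

lemma eisenstein_q_cong_1: "cong_mod2 eisenstein_q (\<lambda>_. 1)"
proof (rule cong_mod2I)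
  show "int_coeffs (\<lambda>q. 120 * eval_fps (sigma_fps 3) q)"
    by (intro int_coeffs_mult int_coeffs_sigma int_coeffs_numeral)
qed (auto simp: eisenstein_q_eq)

section \<open>The modular functions in terms of q\<close>

lemma norm_to_q_less_one: "Im z > 0 \<Longrightarrow> norm (to_q z) < 1"
  by (simp add: to_q_def)

lemma to_q_nonzero [simp]: "to_q z \<noteq> 0"
  by (simp add: to_q_def)

lemma to_q_of_nat_mult: "to_q (of_nat N * z) = to_q z ^ N"
  unfolding to_q_def exp_of_nat_mult[symmetric] by (simp add: mult_ac)

text \<open>All three modular functions have a simple pole at q = 0. Multiplying by q leaves a
  function holomorphic on the disc, whose Taylor series converges there; shifting the series by one
  restores the pole.\<close>

lemma has_q_expansion_simple_pole:
  assumes "f holomorphic_on ball 0 1" "\<And>z. Im z > 0 \<Longrightarrow> g z = f (to_q z) / to_q z"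
  shows "has_q_expansion g (fls_shift 1 (fps_to_fls (fps_expansion f 0)))"
proof -
  have hol: "f holomorphic_on eball 0 1"
    using assms(1) by (simp add: one_ereal_def)
  have radius: "fps_conv_radius (fps_expansion f 0) \<ge> 1"
    by (rule conv_radius_fps_expansion[OF hol])
  have "eval_fls (fls_shift 1 (fps_to_fls (fps_expansion f 0))) (to_q z) = g z" if "Im z > 0" for z
  proof -
    have "ereal (norm (to_q z)) < 1"
      using norm_to_q_less_one[OF that] by simp
    then show ?thesis
      using assms(2)[OF that] radius eval_fps_expansion'[OF hol]
      by (simp add: eval_fls_shift eval_fps_to_fls less_le_trans[of _ 1] power_int_minus field_simps)
  qed
  with radius show ?thesis
    by (simp add: has_q_expansion_def)
qed

text \<open>The function q j in the variable q, with the pole at q = 0 removed;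
  \<open>fricke_q\<close> below plays the same role for the Fricke hauptmoduln.\<close>

definition klein_q :: "complex \<Rightarrow> complex" where
  "klein_q q = eisenstein_q q ^ 3 * inverse (euler_prod q ^ 24)"

lemma klein_j_eq:
  assumes "Im z > 0"
  shows "klein_j z = klein_q (to_q z) / to_q z"
proof -
  have "modular_discr z = to_q z * euler_prod (to_q z) ^ 24"
    unfolding modular_discr_def euler_prod_def
    by (subst prodinf_power[OF convergent_prod_euler[OF norm_to_q_less_one[OF assms]]]) simp
  then show ?thesis
    by (simp add: klein_j_def klein_q_def eisenstein_E4_def eisenstein_q_def divide_inverse)
qed

definition fricke_q :: "nat \<Rightarrow> complex \<Rightarrow> complex" where
  "fricke_q N q = euler_prod q ^ (24 div (N - 1)) * inverse (euler_prod (q ^ N) ^ (24 div (N - 1)))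
     + of_nat (24 div (N - 1)) * q
     + of_nat N ^ (12 div (N - 1)) * q ^ 2 *
       (euler_prod (q ^ N) ^ (24 div (N - 1)) * inverse (euler_prod q ^ (24 div (N - 1))))"

lemma fricke_hauptmodul_eq:
  assumes "N > 1" "(N - 1) dvd 24"
  shows "fricke_hauptmodul N z = fricke_q N (to_q z) / to_q z"
proof -
  define k where "k = 24 div (N - 1)"
  define P where "P = euler_prod (to_q z)"
  define PN where "PN = euler_prod (to_q z ^ N)"
  define a where "a = exp (2 * of_real pi * \<i> * z / 24)"
  \<comment> \<open>This is exactness of the division of 24 by N - 1. It makes the fractional powers
    of q cancel: with a = q^(1/24), the eta quotient contributes a^(k - N k) = a^(-24) =
    1/q.\<close>
  have k: "N * k = k + 24"
    using assms by (cases N) (auto simp: k_def)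
  have eta: "dedekind_eta z = a * P"
    by (simp add: dedekind_eta_def a_def P_def euler_prod_def)
  have "exp (2 * of_real pi * \<i> * (of_nat N * z) / 24) = a ^ N"
    unfolding a_def exp_of_nat_mult[symmetric] by (simp add: mult_ac)
  then have etaN: "dedekind_eta (of_nat N * z) = a ^ N * PN"
    by (simp add: dedekind_eta_def to_q_of_nat_mult PN_def euler_prod_def)
  have a24: "a ^ 24 = to_q z"
    unfolding a_def to_q_def exp_of_nat_mult[symmetric] by (simp add: mult_ac)
  have "a \<noteq> 0"
    by (simp add: a_def)
  have aNk: "(a ^ N) ^ k = a ^ k * to_q z"
    by (simp add: power_mult[symmetric] k power_add a24)
  have "(dedekind_eta z / dedekind_eta (of_nat N * z)) ^ k = P ^ k * inverse (PN ^ k) / to_q z"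
    unfolding eta etaN power_divide power_mult_distrib aNk
    using \<open>a \<noteq> 0\<close> by (simp add: divide_inverse mult_ac)
  moreover have "(dedekind_eta (of_nat N * z) / dedekind_eta z) ^ k = to_q z * (PN ^ k * inverse (P ^ k))"
    unfolding eta etaN power_divide power_mult_distrib aNk
    using \<open>a \<noteq> 0\<close> by (simp add: divide_inverse mult_ac)
  ultimately show ?thesis
    unfolding fricke_hauptmodul_def fricke_q_def k_def[symmetric] P_def[symmetric] PN_def[symmetric]
    by (simp add: add_divide_distrib power2_eq_square)
qed

section \<open>Congruence of all three functions with 1 / P(q)^24\<close>

lemma klein_q_cong: "cong_mod2 klein_q (\<lambda>q. inverse (euler_prod q ^ 24))"
proof -
  have "int_coeffs (\<lambda>q. inverse (euler_prod q ^ 24))"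
    by (intro int_coeffs_inverse int_coeffs_power int_coeffs_euler_prod) (auto simp: euler_prod_nonzero)
  then have "cong_mod2 klein_q (\<lambda>q. 1 ^ 3 * inverse (euler_prod q ^ 24))"
    unfolding klein_q_def[abs_def]
    by (intro cong_mod2_mult cong_mod2_power eisenstein_q_cong_1 cong_mod2_refl)
  then show ?thesis by simp
qed

lemma fricke_q_cong:
  assumes N: "even N" "N > 1" "(N - 1) dvd 24"
    and cong: "cong_mod2 (\<lambda>q. euler_prod (q ^ N)) (\<lambda>q. euler_prod q ^ N)"
  shows "cong_mod2 (fricke_q N) (\<lambda>q. inverse (euler_prod q ^ 24))"
proof -
  define k where "k = 24 div (N - 1)"
  have k: "N * k = k + 24"
    using N by (cases N) (auto simp: k_def)
  \<comment> \<open>Since N - 1 is odd, all factors 2 of 24 lie in k. Hence the middle term k q of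
    \<open>fricke_q N\<close> is even, and the exponent 12 / (N - 1) of N in the last term is l = k
    / 2.\<close>
  have "k * (N - 1) = 24" "odd (N - 1)"
    using N by (auto simp: k_def)
  then have "even k"
    by (metis even_mult_iff even_numeral)
  then obtain l where l: "k = 2 * l" by blast
  have "12 div (N - 1) = l"
    using \<open>k * (N - 1) = 24\<close> N(2) nonzero_mult_div_cancel_right[of "N - 1" l] by (simp add: l)
  have "l > 0"
    using k l by (cases l) auto
  \<comment> \<open>A positive power of the even number N, so the last term of
    \<open>fricke_q N\<close> is even too.\<close>
  then obtain M where M: "N ^ l = 2 * M"
    using N(1) by (metis dvd_def dvd_power dvd_trans)
  have nz: "euler_prod q \<noteq> 0" "euler_prod (q ^ N) \<noteq> 0" if "norm q < 1" for q
    using that N(2) by (auto intro!: euler_prod_nonzero norm_power_less_one)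
  have int: "int_coeffs (\<lambda>q. inverse (euler_prod q ^ j))" for j
    using nz by (intro int_coeffs_inverse int_coeffs_power int_coeffs_euler_prod) auto
  have intN: "int_coeffs (\<lambda>q. euler_prod (q ^ N))"
    using cong by (simp add: cong_mod2_def)
  have "cong_mod2 (\<lambda>q. euler_prod q ^ k * inverse (euler_prod (q ^ N) ^ k))
      (\<lambda>q. euler_prod q ^ k * inverse ((euler_prod q ^ N) ^ k))"
    using nz N(2) by (intro cong_mod2_mult cong_mod2_refl cong_mod2_inverse cong_mod2_power cong
        int_coeffs_power int_coeffs_euler_prod) (auto simp: power_0_left)
  moreover have "cong_mod2 (\<lambda>q. euler_prod q ^ k * inverse ((euler_prod q ^ N) ^ k))
      (\<lambda>q. inverse (euler_prod q ^ 24))"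
    unfolding power_mult[symmetric]
  proof (rule cong_mod2I)
    \<comment> \<open>Here N k = k + 24 gives equality on the disc, where the Euler product has no
      zeros; \<open>cong_mod2I\<close> with h = 0 turns this into a congruence.\<close>
    show "euler_prod q ^ k * inverse (euler_prod q ^ (N * k)) = inverse (euler_prod q ^ 24) + 2 * 0"
      if "norm q < 1" for q
      using nz[OF that] by (simp add: k power_add)
  qed (use int in auto)
  moreover have "cong_mod2 (fricke_q N) (\<lambda>q. euler_prod q ^ k * inverse (euler_prod (q ^ N) ^ k))"
  proof (rule cong_mod2I)
    show "int_coeffs (\<lambda>q. euler_prod q ^ k * inverse (euler_prod (q ^ N) ^ k))"
      using calculation(1) by (simp add: cong_mod2_def)
    show "int_coeffs (\<lambda>q. of_nat l * q + of_nat M * q ^ 2 *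
        (euler_prod (q ^ N) ^ k * inverse (euler_prod q ^ k)))"
      using int_coeffs_of_int[of "int l"] int_coeffs_of_int[of "int M"]
      by (intro int_coeffs_add int_coeffs_mult int_coeffs_power intN int int_coeffs_id) simp_all
    show "fricke_q N q = euler_prod q ^ k * inverse (euler_prod (q ^ N) ^ k) + 2 * (of_nat l * q +
        of_nat M * q ^ 2 * (euler_prod (q ^ N) ^ k * inverse (euler_prod q ^ k)))" for q
    proof -
      have "of_nat N ^ l = (2 * of_nat M :: complex)"
        using M by (metis of_nat_mult of_nat_numeral of_nat_power)
      then show ?thesis
        unfolding fricke_q_def k_def[symmetric] \<open>12 div (N - 1) = l\<close>
        by (simp add: l algebra_simps)
    qed
  qed
  ultimately show ?thesis
    using cong_mod2_trans by blast
qed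

theorem theorem2p1:
  shows "has_q_expansion klein_j (q_expansion klein_j)
    \<and> has_q_expansion (fricke_hauptmodul 2) (q_expansion (fricke_hauptmodul 2))
    \<and> has_q_expansion (fricke_hauptmodul 4) (q_expansion (fricke_hauptmodul 4))
    \<and> (\<forall>n::int. \<exists>c c2 c4 :: int.
          q_coeff klein_j n = of_int c
        \<and> q_coeff (fricke_hauptmodul 2) n = of_int c2
        \<and> q_coeff (fricke_hauptmodul 4) n = of_int c4
        \<and> [c = c2] (mod 2) \<and> [c2 = c4] (mod 2))"
proof (intro conjI allI)
  define F where "F f = fls_shift 1 (fps_to_fls (fps_expansion f 0))" for f :: "complex \<Rightarrow> complex"
  have fricke2: "cong_mod2 (fricke_q 2) (\<lambda>q. inverse (euler_prod q ^ 24))"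
    by (rule fricke_q_cong) (auto simp: euler_prod_square_cong)
  have fricke4: "cong_mod2 (fricke_q 4) (\<lambda>q. inverse (euler_prod q ^ 24))"
    by (rule fricke_q_cong) (auto simp: euler_prod_fourth_cong)
  have expansion: "has_q_expansion klein_j (F klein_q)"
    "has_q_expansion (fricke_hauptmodul 2) (F (fricke_q 2))"
    "has_q_expansion (fricke_hauptmodul 4) (F (fricke_q 4))"
    unfolding F_def using klein_q_cong fricke2 fricke4
    by (auto intro!: has_q_expansion_simple_pole klein_j_eq fricke_hauptmodul_eq
          simp: cong_mod2_def int_coeffs_def)
  then show "has_q_expansion klein_j (q_expansion klein_j)"
    "has_q_expansion (fricke_hauptmodul 2) (q_expansion (fricke_hauptmodul 2))"
    "has_q_expansion (fricke_hauptmodul 4) (q_expansion (fricke_hauptmodul 4))"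
    by (simp_all add: q_expansion_eqI)
  fix n :: int
  have coeff: "q_coeff klein_j n = fls_nth (F klein_q) n"
    "q_coeff (fricke_hauptmodul 2) n = fls_nth (F (fricke_q 2)) n"
    "q_coeff (fricke_hauptmodul 4) n = fls_nth (F (fricke_q 4)) n"
    using expansion by (simp_all add: q_coeff_def q_expansion_eqI)
  have fls_cong: "\<exists>a b. fls_nth (F f) n = of_int a \<and> fls_nth (F g) n = of_int b \<and> [a = b] (mod 2)"
    if "cong_mod2 f g" for f g
  \<comment> \<open>Because of the shift, coefficient n of \<open>F f\<close> is Taylor coefficient
    n + 1 of f; below the pole order both coefficients are 0.\<close>
  proof (cases "n + 1 < 0")
    case True
    then show ?thesis
      by (intro exI[of _ 0]) (auto simp: F_def)
  next
    case False
    then show ?thesis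
      using cong_mod2_fps_nth[OF that, of "nat (n + 1)"] by (simp add: F_def) blast
  qed
  obtain c c2 where 1: "fls_nth (F klein_q) n = of_int c" "fls_nth (F (fricke_q 2)) n = of_int c2"
    "[c = c2] (mod 2)"
    using fls_cong[OF cong_mod2_trans[OF klein_q_cong cong_mod2_sym[OF fricke2]]] by blast
  obtain c2' c4 where 2: "fls_nth (F (fricke_q 2)) n = of_int c2'" "fls_nth (F (fricke_q 4)) n = of_int c4"
    "[c2' = c4] (mod 2)"
    using fls_cong[OF cong_mod2_trans[OF fricke2 cong_mod2_sym[OF fricke4]]] by blast
  \<comment> \<open>Both integers represent the same complex coefficient, so the two congruences can
    be chained.\<close>
  have "c2' = c2"
    using 1(2) 2(1) by simp
  with 1 2 coeff show "\<exists>c c2 c4. q_coeff klein_j n = of_int c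
      \<and> q_coeff (fricke_hauptmodul 2) n = of_int c2
      \<and> q_coeff (fricke_hauptmodul 4) n = of_int c4
      \<and> [c = c2] (mod 2) \<and> [c2 = c4] (mod 2)"
    by auto
qed

end
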